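(* For any graph $G$ and any positive integers $t$ and $n$, \[\left\lceil \frac{n}{n+1}\,\pi^*_{2t}(G)\right\rceil \le \pi_t^*(G\Box K_n)\le \pi^*_{2t}(G).\]
   Context: Graphs are finite simple graphs. A distribution on a graph $G=(V,E)$ is a function $D:V\to\mathbb{N}$, with size $|D|=\sum_v D(v)$. A pebbling move removes two pebbles from a vertex having at least two pebbles and places one pebble on a neighbor. A distribution $D$ is $t$-solvable if for every vertex $v$, some sequence of pebbling moves starting from $D$ results in a distribution with at least $t$ pebbles on $v$. The optimal $t$-pebbling number $\pi_t^*(G)$ is the minimum size of a $t$-solvable distribution on $G$. $K_n$ is the complete graph on $n$ vertices and $G\Box H$ denotes the Cartesian product of graphs. *)

theory Defs
  imports Complex_Main "Graph_Theory.Graph_Theory"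
begin

text \<open>
  A finite simple graph is a \<^locale>\<open>pair_graph\<close>: a finite, loop-free digraph without parallel arcs
  whose arc set is symmetric, so that each edge is represented by both of its orientations.
\<close>

definition cartesian_product ::
    "'a pair_pre_digraph \<Rightarrow> 'b pair_pre_digraph \<Rightarrow> ('a \<times> 'b) pair_pre_digraph" (infixl "\<box>" 70) where
  "G \<box> H = \<lparr> pverts = pverts G \<times> pverts H,
     parcs = {((u, x), (v, y)) | u x v y.
       u = v \<and> u \<in> pverts G \<and> (x, y) \<in> parcs H \<or>
       x = y \<and> x \<in> pverts H \<and> (u, v) \<in> parcs G} \<rparr>"

lemma pair_graph_cartesian_product:
  assumes "pair_graph G" "pair_graph H"
  shows "pair_graph (G \<box> H)"
proof -
  interpret G: pair_graph G by fact
  interpret H: pair_graph H by fact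
  have sub: "parcs (G \<box> H) \<subseteq> pverts (G \<box> H) \<times> pverts (G \<box> H)"
    unfolding cartesian_product_def using G.wellformed' H.wellformed' by fastforce
  have fin: "finite (pverts (G \<box> H))"
    by (simp add: cartesian_product_def G.pair_finite_verts H.pair_finite_verts)
  have "sym (parcs G)" "sym (parcs H)"
    using G.pair_sym_arcs H.pair_sym_arcs by (simp_all add: symmetric_def)
  then have sym: "sym (parcs (G \<box> H))"
    unfolding cartesian_product_def sym_def by simp blast
  show ?thesis
  proof
    show "finite (parcs (G \<box> H))"
      using fin by (intro finite_subset[OF sub]) simp
    show "fst e \<noteq> snd e" if "e \<in> parcs (G \<box> H)" for e
      using that G.pair_no_loops[of "(x, y)" for x y] H.pair_no_loops[of "(x, y)" for x y]
      unfolding cartesian_product_def by fastforce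
    show "fst e \<in> pverts (G \<box> H)" if "e \<in> parcs (G \<box> H)" for e
      using subsetD[OF sub that] by (simp add: mem_Times_iff)
    show "snd e \<in> pverts (G \<box> H)" if "e \<in> parcs (G \<box> H)" for e
      using subsetD[OF sub that] by (simp add: mem_Times_iff)
    show "symmetric (with_proj (G \<box> H))"
      using sym by (simp add: symmetric_def)
  qed (rule fin)
qed

text \<open>
  A function from the vertex set to the natural numbers is represented by its extension by zero
  to the whole vertex type.
\<close>

definition distributions :: "'a pair_pre_digraph \<Rightarrow> ('a \<Rightarrow> nat) set" where
  "distributions G = {D. \<forall>v. v \<notin> pverts G \<longrightarrow> D v = 0}"

definition dist_size :: "'a pair_pre_digraph \<Rightarrow> ('a \<Rightarrow> nat) \<Rightarrow> nat" where
  "dist_size G D = (\<Sum>v\<in>pverts G. D v)"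

text \<open>There are no loops, so the two updates below affect different vertices.\<close>

definition pebbling_move :: "'a pair_pre_digraph \<Rightarrow> ('a \<Rightarrow> nat) \<Rightarrow> ('a \<Rightarrow> nat) \<Rightarrow> bool" where
  "pebbling_move G D D' \<longleftrightarrow>
     (\<exists>u v. (u, v) \<in> parcs G \<and> 2 \<le> D u \<and> D' = D(u := D u - 2, v := D v + 1))"

definition solvable :: "'a pair_pre_digraph \<Rightarrow> nat \<Rightarrow> ('a \<Rightarrow> nat) \<Rightarrow> bool" where
  "solvable G t D \<longleftrightarrow> (\<forall>v\<in>pverts G. \<exists>D'. (pebbling_move G)\<^sup>*\<^sup>* D D' \<and> t \<le> D' v)"

definition optimal_pebbling_number :: "nat \<Rightarrow> 'a pair_pre_digraph \<Rightarrow> nat" where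
  "optimal_pebbling_number t G =
     (LEAST s. \<exists>D\<in>distributions G. solvable G t D \<and> dist_size G D = s)"

text \<open>The minimum is taken over a nonempty set, hence attained.\<close>

lemma optimal_pebbling_number_attained:
  "\<exists>D\<in>distributions G. solvable G t D \<and> dist_size G D = optimal_pebbling_number t G"
proof -
  let ?D = "\<lambda>v. if v \<in> pverts G then t else 0"
  have "?D \<in> distributions G" by (simp add: distributions_def)
  moreover have "solvable G t ?D"
    unfolding solvable_def by (intro ballI exI[of _ ?D]) simp
  ultimately have "\<exists>s. \<exists>D\<in>distributions G. solvable G t D \<and> dist_size G D = s" by blast
  then show ?thesis
    unfolding optimal_pebbling_number_def by (rule LeastI_ex)
qed

end

theory Submission
  imports Defs
begin

text \<open>
  For the upper bound, a \<open>2t\<close>-solvable distribution of \<open>G\<close> placed in a single layer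
  of \<open>G \<box> K\<close> is \<open>t\<close>-solvable, since \<open>2t\<close> pebbles can be halved into any other layer.
  For the lower bound, fix a layer \<open>x\<close> and project a \<open>t\<close>-solvable distribution of \<open>G \<box> K\<close>
  to \<open>G\<close>, counting pebbles of layer \<open>x\<close> twice and all others once. Every move of the product can
  be imitated below the projection, and \<open>t\<close> pebbles on \<open>(v, x)\<close> project to \<open>2t\<close> pebbles on \<open>v\<close>,
  so the projection is \<open>2t\<close>-solvable. Its size is that of the distribution plus that of
  layer \<open>x\<close>, and some layer has at most the average size.
\<close>

lemma optimal_pebbling_number_le:
  assumes "D \<in> distributions G" "solvable G t D"
  shows "optimal_pebbling_number t G \<le> dist_size G D"
  unfolding optimal_pebbling_number_def using assms by (intro Least_le) blast

text \<open>Serves both bounds: with \<open>k = t\<close> it halves \<open>2 * t\<close> pebbles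
  into another layer, and with \<open>k = w a\<close> it imitates in \<open>G\<close> one product
  move inside layer \<open>a\<close>.\<close>

lemma pebbling_moves_along_arc:
  assumes "(u, v) \<in> parcs G" "u \<noteq> v" "2 * k \<le> D u"
  shows "(pebbling_move G)\<^sup>*\<^sup>* D (D(u := D u - 2 * k, v := D v + k))"
  using assms(3)
proof (induction k)
  case 0
  then show ?case by simp
next
  case (Suc k)
  let ?E = "D(u := D u - 2 * k, v := D v + k)"
  have "pebbling_move G ?E (?E(u := ?E u - 2, v := ?E v + 1))"
    unfolding pebbling_move_def using Suc.prems assms(1,2) by (intro exI[of _ u] exI[of _ v]) auto
  moreover have "?E(u := ?E u - 2, v := ?E v + 1) = D(u := D u - 2 * Suc k, v := D v + Suc k)"
    using assms(2) by (auto simp: fun_eq_iff)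
  moreover have "(pebbling_move G)\<^sup>*\<^sup>* D ?E"
    using Suc.prems by (intro Suc.IH) simp
  ultimately show ?case
    by (metis rtranclp.rtrancl_into_rtrancl)
qed

definition layer :: "'b \<Rightarrow> ('a \<Rightarrow> nat) \<Rightarrow> 'a \<times> 'b \<Rightarrow> nat" where
  "layer x D = (\<lambda>(v, y). if y = x then D v else 0)"

lemma layer_distributions:
  "D \<in> distributions G \<Longrightarrow> x \<in> pverts K \<Longrightarrow> layer x D \<in> distributions (G \<box> K)"
  by (auto simp: layer_def distributions_def cartesian_product_def)

lemma dist_size_layer:
  assumes "finite (pverts K)" "x \<in> pverts K"
  shows "dist_size (G \<box> K) (layer x D) = dist_size G D"
  using assms
  by (simp add: dist_size_def layer_def cartesian_product_def flip: sum.cartesian_product)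

lemma pebbling_moves_layer:
  assumes "(pebbling_move G)\<^sup>*\<^sup>* D D'" "x \<in> pverts K"
  shows "(pebbling_move (G \<box> K))\<^sup>*\<^sup>* (layer x D) (layer x D')"
  using assms(1)
proof induction
  case base
  show ?case by simp
next
  case (step E E')
  then obtain u v where uv: "(u, v) \<in> parcs G" "2 \<le> E u" "E' = E(u := E u - 2, v := E v + 1)"
    unfolding pebbling_move_def by blast
  have "((u, x), (v, x)) \<in> parcs (G \<box> K)"
    using uv(1) assms(2) by (simp add: cartesian_product_def)
  moreover have "layer x E' =
      (layer x E)((u, x) := layer x E (u, x) - 2, (v, x) := layer x E (v, x) + 1)"
    by (auto simp: uv(3) layer_def fun_eq_iff)
  moreover have "2 \<le> layer x E (u, x)"
    using uv(2) by (simp add: layer_def)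
  ultimately have "pebbling_move (G \<box> K) (layer x E) (layer x E')"
    unfolding pebbling_move_def by blast
  with step.IH show ?case by simp
qed

text \<open>Gather \<open>2 * t\<close> pebbles on \<open>(v, x)\<close> by moves inside the layer,
  then cross directly to \<open>(v, y)\<close>. Hence \<open>complete\<close> is stated as adjacency
  of \<open>x\<close> to the other vertices of \<open>K\<close>.\<close>

lemma solvable_layer:
  assumes "solvable G (2 * t) D" "x \<in> pverts K"
    and complete: "\<And>y. y \<in> pverts K \<Longrightarrow> y \<noteq> x \<Longrightarrow> (x, y) \<in> parcs K"
  shows "solvable (G \<box> K) t (layer x D)"
  unfolding solvable_def
proof
  fix p assume "p \<in> pverts (G \<box> K)"
  then obtain v y where p: "p = (v, y)" "v \<in> pverts G" "y \<in> pverts K"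
    by (auto simp: cartesian_product_def)
  obtain E where E: "(pebbling_move G)\<^sup>*\<^sup>* D E" "2 * t \<le> E v"
    using assms(1) p(2) unfolding solvable_def by blast
  note moves = pebbling_moves_layer[OF E(1) assms(2)]
  show "\<exists>D'. (pebbling_move (G \<box> K))\<^sup>*\<^sup>* (layer x D) D' \<and> t \<le> D' p"
  proof (cases "y = x")
    case True
    then show ?thesis
      using moves E(2) p(1) by (intro exI[of _ "layer x E"]) (simp add: layer_def)
  next
    case False
    let ?L = "layer x E"
    have "((v, x), (v, y)) \<in> parcs (G \<box> K)"
      using complete[OF p(3) False] p(2) by (simp add: cartesian_product_def)
    then have "(pebbling_move (G \<box> K))\<^sup>*\<^sup>* ?L
        (?L((v, x) := ?L (v, x) - 2 * t, (v, y) := ?L (v, y) + t))" (is "rtranclp _ _ ?F")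
      using False E(2) by (intro pebbling_moves_along_arc) (auto simp: layer_def)
    with moves have "(pebbling_move (G \<box> K))\<^sup>*\<^sup>* (layer x D) ?F"
      by (rule rtranclp_trans)
    then show ?thesis
      using p(1) by (intro exI[of _ ?F]) simp
  qed
qed

text \<open>The weights stay general so that moves are imitated uniformly for all layers; later
  \<open>w\<close> is 2 on the chosen layer and 1 elsewhere.\<close>

definition projection :: "'b pair_pre_digraph \<Rightarrow> ('b \<Rightarrow> nat) \<Rightarrow> ('a \<times> 'b \<Rightarrow> nat) \<Rightarrow> 'a \<Rightarrow> nat" where
  "projection K w D = (\<lambda>v. \<Sum>y\<in>pverts K. w y * D (v, y))"

lemma projection_update:
  assumes "finite (pverts K)" "a \<in> pverts K"
  shows "projection K w (D((u, a) := D (u, a) + k)) v =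
    projection K w D v + (if v = u then w a * k else 0)"
proof -
  have "w y * (D((u, a) := D (u, a) + k)) (v, y) =
      w y * D (v, y) + (if y = a then if v = u then w a * k else 0 else 0)" for y
    by (simp add: algebra_simps)
  then show ?thesis
    using assms by (simp add: projection_def sum.distrib)
qed

text \<open>A move within a copy of \<open>K\<close> cannot increase the projection, and a move
  within layer \<open>a\<close> projects to \<open>w a\<close> moves of \<open>G\<close>. The former
  may lose weight, so \<open>E\<close> is only required to dominate the projection.\<close>

lemma pebbling_move_projection:
  assumes "pair_graph G" "pair_graph K"
    and w: "\<And>y. y \<in> pverts K \<Longrightarrow> 1 \<le> w y \<and> w y \<le> 2"
    and move: "pebbling_move (G \<box> K) D D'"
    and E: "\<And>v. projection K w D v \<le> E v"
  shows "\<exists>E'. (pebbling_move G)\<^sup>*\<^sup>* E E' \<and> (\<forall>v. projection K w D' v \<le> E' v)"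
proof -
  interpret G: pair_graph G by fact
  interpret K: pair_graph K by fact
  interpret GK: pair_graph "G \<box> K"
    using assms(1,2) by (rule pair_graph_cartesian_product)
  obtain u a v b where arc: "((u, a), (v, b)) \<in> parcs (G \<box> K)" and D: "2 \<le> D (u, a)"
    and D': "D' = D((u, a) := D (u, a) - 2, (v, b) := D (v, b) + 1)"
    using move unfolding pebbling_move_def by (metis surj_pair)
  have ab: "a \<in> pverts K" "b \<in> pverts K"
    using arc K.wellformed' by (auto simp: cartesian_product_def)
  have "(u, a) \<noteq> (v, b)"
    using GK.pair_no_loops[OF arc] by simp
  \<comment> \<open>\<open>F\<close> is the state between removal and placement. Both
    \<open>D\<close> and \<open>D'\<close> arise from it by adding pebbles, which avoids truncated
    subtraction in the projections.\<close>
  define F where "F = D((u, a) := D (u, a) - 2)"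
  have DF: "D = F((u, a) := F (u, a) + 2)"
    using D by (auto simp: F_def fun_eq_iff)
  have D'F: "D' = F((v, b) := F (v, b) + 1)"
    using \<open>(u, a) \<noteq> (v, b)\<close> by (auto simp: F_def D' fun_eq_iff)
  have WD: "projection K w D z = projection K w F z + (if z = u then w a * 2 else 0)" for z
    by (subst DF, rule projection_update) (use ab in auto)
  have WD': "projection K w D' z = projection K w F z + (if z = v then w b * 1 else 0)" for z
    by (subst D'F, rule projection_update) (use ab in auto)
  show ?thesis
  proof (cases "u = v")
    case True
    \<comment> \<open>At \<open>u\<close> the weight \<open>2 * w a\<close> is replaced by
      \<open>w b\<close>, and \<open>w b \<le> 2 \<le> 2 * w a\<close>.\<close>
    have "projection K w D' z \<le> E z" for z
      using E[of z] w[OF ab(1)] w[OF ab(2)] True by (auto simp: WD WD' split: if_splits)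
    then show ?thesis by blast
  next
    case False
    then have uv: "(u, v) \<in> parcs G" "a = b"
      using arc by (auto simp: cartesian_product_def)
    let ?E = "E(u := E u - 2 * w a, v := E v + w a)"
    \<comment> \<open>The two pebbles on \<open>(u, a)\<close> alone contribute
      \<open>2 * w a\<close> to the projection at \<open>u\<close>.\<close>
    have "2 * w a \<le> E u"
      using E[of u] by (simp add: WD)
    with uv(1) False have "(pebbling_move G)\<^sup>*\<^sup>* E ?E"
      by (rule pebbling_moves_along_arc)
    moreover have "projection K w D' z \<le> ?E z" for z
      using E[of z] False uv(2) by (auto simp: WD WD' split: if_splits)
    ultimately show ?thesis by blast
  qed
qed

lemma pebbling_moves_projection:
  assumes "pair_graph G" "pair_graph K"
    and "\<And>y. y \<in> pverts K \<Longrightarrow> 1 \<le> w y \<and> w y \<le> 2"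
    and "(pebbling_move (G \<box> K))\<^sup>*\<^sup>* D D'"
  shows "\<exists>E. (pebbling_move G)\<^sup>*\<^sup>* (projection K w D) E \<and> (\<forall>v. projection K w D' v \<le> E v)"
  using assms(4)
proof induction
  case base
  show ?case by blast
next
  case (step F F')
  then obtain E where E: "(pebbling_move G)\<^sup>*\<^sup>* (projection K w D) E"
    "\<And>v. projection K w F v \<le> E v"
    by blast
  obtain E' where "(pebbling_move G)\<^sup>*\<^sup>* E E'" "\<forall>v. projection K w F' v \<le> E' v"
    using pebbling_move_projection[OF assms(1-3) step.hyps(2) E(2)] by blast
  with E(1) show ?case by (meson rtranclp_trans)
qed

lemma solvable_projection:
  assumes "pair_graph G" "pair_graph K" "x \<in> pverts K" "solvable (G \<box> K) t D"
  shows "solvable G (2 * t) (projection K (\<lambda>y. if y = x then 2 else 1) D)"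
    (is "solvable _ _ (projection K ?w D)")
  unfolding solvable_def
proof
  interpret K: pair_graph K by fact
  fix v assume "v \<in> pverts G"
  then have "(v, x) \<in> pverts (G \<box> K)"
    using assms(3) by (simp add: cartesian_product_def)
  then obtain D' where D': "(pebbling_move (G \<box> K))\<^sup>*\<^sup>* D D'" "t \<le> D' (v, x)"
    using assms(4) unfolding solvable_def by blast
  obtain E where E: "(pebbling_move G)\<^sup>*\<^sup>* (projection K ?w D) E"
    "\<forall>v. projection K ?w D' v \<le> E v"
    using pebbling_moves_projection[OF assms(1,2) _ D'(1), of ?w] by force
  \<comment> \<open>The single summand at \<open>x\<close>, where the weight is 2, already
    suffices.\<close>
  have "?w x * D' (v, x) \<le> projection K ?w D' v"
    unfolding projection_def by (rule member_le_sum) (use assms(3) in auto)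
  also have "\<dots> \<le> E v"
    using E(2) by blast
  finally have "2 * t \<le> E v"
    using D'(2) by simp
  with E(1) show "\<exists>D'. (pebbling_move G)\<^sup>*\<^sup>* (projection K ?w D) D' \<and> 2 * t \<le> D' v"
    by blast
qed

lemma projection_distributions:
  "D \<in> distributions (G \<box> K) \<Longrightarrow> projection K w D \<in> distributions G"
  by (auto simp: distributions_def cartesian_product_def projection_def)

lemma dist_size_projection:
  assumes "finite (pverts K)" "x \<in> pverts K"
  shows "dist_size G (projection K (\<lambda>y. if y = x then 2 else 1) D) =
    dist_size (G \<box> K) D + (\<Sum>v\<in>pverts G. D (v, x))"
proof -
  have "projection K (\<lambda>y. if y = x then 2 else 1) D v =
      (\<Sum>y\<in>pverts K. D (v, y) + (if y = x then D (v, x) else 0))" for v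
    unfolding projection_def by (rule sum.cong) auto
  then have "projection K (\<lambda>y. if y = x then 2 else 1) D v =
      (\<Sum>y\<in>pverts K. D (v, y)) + D (v, x)" for v
    using assms by (simp add: sum.distrib)
  then show ?thesis
    by (simp add: dist_size_def cartesian_product_def sum.distrib sum.cartesian_product)
qed

theorem theorem3p1:
  fixes G :: "'a pair_pre_digraph" and K :: "'b pair_pre_digraph" and t n :: nat
  assumes "pair_graph G"
    and "0 < t" and "0 < n"
    and "complete_digraph n (with_proj K)"
  shows "\<lceil>real n / (real n + 1) * real (optimal_pebbling_number (2 * t) G)\<rceil>
           \<le> int (optimal_pebbling_number t (G \<box> K))
         \<and> optimal_pebbling_number t (G \<box> K) \<le> optimal_pebbling_number (2 * t) G"
proof -
  interpret K: pair_graph K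
    using assms(4) by (rule pair_graphI_complete)
  have K: "pair_graph K" ..
  have card: "card (pverts K) = n"
    and arcs: "\<And>x y. x \<in> pverts K \<Longrightarrow> y \<in> pverts K \<Longrightarrow> y \<noteq> x \<Longrightarrow> (x, y) \<in> parcs K"
    using assms(4) by (auto simp: complete_digraph_pair_def)
  let ?p = "optimal_pebbling_number (2 * t) G" and ?q = "optimal_pebbling_number t (G \<box> K)"
  have upper: "?q \<le> ?p"
  proof -
    obtain x where x: "x \<in> pverts K"
      using card \<open>0 < n\<close> by fastforce
    obtain D where D: "D \<in> distributions G" "solvable G (2 * t) D" "dist_size G D = ?p"
      using optimal_pebbling_number_attained by blast
    have "?q \<le> dist_size (G \<box> K) (layer x D)"
      using D x arcs by (intro optimal_pebbling_number_le layer_distributions solvable_layer) auto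
    with D(3) x show ?thesis
      by (simp add: dist_size_layer)
  qed
  \<comment> \<open>The averaging is done without division or choice of a smallest layer: the bounds
    for all \<open>n\<close> layers are added, and the layer sizes sum to \<open>?q\<close>.\<close>
  have lower: "n * ?p \<le> (n + 1) * ?q"
  proof -
    obtain D where D: "D \<in> distributions (G \<box> K)" "solvable (G \<box> K) t D" "dist_size (G \<box> K) D = ?q"
      using optimal_pebbling_number_attained by blast
    have "?p \<le> ?q + (\<Sum>v\<in>pverts G. D (v, x))" if "x \<in> pverts K" for x
      using optimal_pebbling_number_le[OF projection_distributions[OF D(1)]
          solvable_projection[OF assms(1) K that D(2)]] that D(3)
      by (simp add: dist_size_projection)
    then have "(\<Sum>x\<in>pverts K. ?p) \<le> (\<Sum>x\<in>pverts K. ?q + (\<Sum>v\<in>pverts G. D (v, x)))"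
      by (rule sum_mono)
    also have "\<dots> = n * ?q + (\<Sum>v\<in>pverts G. \<Sum>x\<in>pverts K. D (v, x))"
      by (simp add: sum.distrib card) (rule sum.swap)
    also have "(\<Sum>v\<in>pverts G. \<Sum>x\<in>pverts K. D (v, x)) = ?q"
      unfolding D(3)[symmetric] dist_size_def by (simp add: cartesian_product_def sum.cartesian_product)
    finally show ?thesis
      by (simp add: card)
  qed
  have "real n * real ?p \<le> (real n + 1) * real ?q"
    using of_nat_mono[OF lower, where ?'a = real] by (simp add: algebra_simps)
  then have "real n / (real n + 1) * real ?p \<le> real ?q"
    by (simp add: field_simps)
  \<comment> \<open>As \<open>?q\<close> is an integer, a bound on the fraction is a bound on its
    ceiling.\<close>
  then show ?thesis
    using upper by (simp add: ceiling_le_iff)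
qed

end
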